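(* Let $\mathbb{H}$ be a (normalized) quantum channel entropy and let $\mathcal{V}\in\mathrm{CPTP}(A\to B)$ be an isometry channel. Then $\mathbb{H}(B|A)_{\mathcal{V}}=-\log|A|$. In particular, every channel entropy takes negative values on isometry channels with $|A|>1$.
   Context: Systems are finite-dimensional; $\mathbf{u}^B=I^B/|B|$; $\log$ is base 2; a state is identified with a channel with trivial input. A superchannel from $\mathrm{CPTP}(A\to B)$ to $\mathrm{CPTP}(A'\to B)$ is $\Theta[\mathcal{N}]=\mathcal{E}^{RB\to B}\circ\mathcal{N}^{A\to B}\circ\mathcal{V}^{A'\to RA}$ with $\mathcal{V}$ an isometry channel and $\mathcal{E}$ a channel; it is mixing if in a realization with minimal $|R|$, $\mathcal{E}(\tau^R\otimes\mathbf{u}^B)=\mathbf{u}^B$ for every density matrix $\tau^R$. For same output, $\mathcal{N}\succ\mathcal{M}$ iff $\mathcal{M}=\Theta[\mathcal{N}]$ for a mixing $\Theta$; for $\mathcal{N}\in\mathrm{CPTP}(A\to B)$, $\mathcal{M}\in\mathrm{CPTP}(A'\to B')$: if $|B|>|B'|$, $\mathcal{N}\succ\mathcal{M}$ iff $\mathcal{N}\succ\mathcal{U}\circ\mathcal{M}$ for some isometry channel $\mathcal{U}:B'\to B$; if $|B|\le|B'|$, iff $\mathcal{W}\circ\mathcal{N}\succ\mathcal{M}$ for some isometry channel $\mathcal{W}:B\to B'$. A (normalized) channel entropy is a function $\mathcal{N}^{A\to B}\mapsto\mathbb{H}(B|A)_{\mathcal{N}}\in\mathbb{R}$ on all channels between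 finite-dimensional systems, not identically zero, such that: (monotonicity) $\mathcal{N}^{A\to B}\succ\mathcal{M}^{A'\to B'}$ implies $\mathbb{H}(B|A)_{\mathcal{N}}\le\mathbb{H}(B'|A')_{\mathcal{M}}$; (additivity) $\mathbb{H}(BB'|AA')_{\mathcal{N}\otimes\mathcal{M}}=\mathbb{H}(B|A)_{\mathcal{N}}+\mathbb{H}(B'|A')_{\mathcal{M}}$; (normalization) the uniform qubit state has entropy $1$. *)

theory Defs
  imports "Jordan_Normal_Form.Matrix"
begin

text \<open>A channel between finite-dimensional systems is represented canonically by the
triple (input dimension |A|, output dimension |B|, Choi matrix).  Index conventions:
a composite index (x,y) of a bipartite system XY is x * |Y| + y; the Choi matrix of
N : A -> B has entries J((a,b),(c,d)) = N(|a><c|)(b,d).\<close>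

type_synonym chan = "nat \<times> nat \<times> complex mat"

definition din :: "chan \<Rightarrow> nat" where "din N = fst N"
definition dout :: "chan \<Rightarrow> nat" where "dout N = fst (snd N)"
definition choi_mat :: "chan \<Rightarrow> complex mat" where "choi_mat N = snd (snd N)"

definition munit :: "nat \<Rightarrow> nat \<Rightarrow> nat \<Rightarrow> complex mat" where
  "munit d a c = mat d d (\<lambda>(i,j). if i = a \<and> j = c then 1 else 0)"

definition choi :: "nat \<Rightarrow> nat \<Rightarrow> (complex mat \<Rightarrow> complex mat) \<Rightarrow> complex mat" where
  "choi m n f = mat (m*n) (m*n) (\<lambda>(i,j). f (munit m (i div n) (j div n)) $$ (i mod n, j mod n))"

definition mk_chan :: "nat \<Rightarrow> nat \<Rightarrow> (complex mat \<Rightarrow> complex mat) \<Rightarrow> chan" where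
  "mk_chan m n f = (m, n, choi m n f)"

definition ch_apply :: "chan \<Rightarrow> complex mat \<Rightarrow> complex mat" where
  "ch_apply N \<rho> = mat (dout N) (dout N) (\<lambda>(b,d).
      \<Sum>a<din N. \<Sum>c<din N. \<rho> $$ (a,c) * choi_mat N $$ (a * dout N + b, c * dout N + d))"

definition mtrace :: "complex mat \<Rightarrow> complex" where
  "mtrace A = (\<Sum>i<dim_row A. A $$ (i,i))"

definition adj :: "complex mat \<Rightarrow> complex mat" where
  "adj V = mat (dim_col V) (dim_row V) (\<lambda>(i,j). cnj (V $$ (j,i)))"

definition psd :: "complex mat \<Rightarrow> bool" where
  "psd A \<longleftrightarrow> A \<in> carrier_mat (dim_row A) (dim_row A) \<and>
     (\<forall>v \<in> carrier_vec (dim_row A). \<exists>r::real. r \<ge> 0 \<and>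
        (\<Sum>i<dim_row A. \<Sum>j<dim_row A. cnj (v $ i) * A $$ (i,j) * v $ j) = complex_of_real r)"

definition density :: "nat \<Rightarrow> complex mat \<Rightarrow> bool" where
  "density d \<tau> \<longleftrightarrow> \<tau> \<in> carrier_mat d d \<and> psd \<tau> \<and> mtrace \<tau> = 1"

definition unif :: "nat \<Rightarrow> complex mat" where
  "unif n = (1 / of_nat n) \<cdot>\<^sub>m 1\<^sub>m n"

definition kron :: "complex mat \<Rightarrow> complex mat \<Rightarrow> complex mat" where
  "kron A B = mat (dim_row A * dim_row B) (dim_col A * dim_col B)
     (\<lambda>(i,j). A $$ (i div dim_row B, j div dim_col B) * B $$ (i mod dim_row B, j mod dim_col B))"

text \<open>CPTP map = positive semidefinite Choi matrix (Choi's theorem) + trace preservation.\<close>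
definition is_channel :: "chan \<Rightarrow> bool" where
  "is_channel N \<longleftrightarrow> din N > 0 \<and> dout N > 0 \<and>
     choi_mat N \<in> carrier_mat (din N * dout N) (din N * dout N) \<and> psd (choi_mat N) \<and>
     (\<forall>a<din N. \<forall>c<din N. (\<Sum>b<dout N. choi_mat N $$ (a * dout N + b, c * dout N + b))
        = (if a = c then 1 else 0))"

definition is_isometry :: "complex mat \<Rightarrow> bool" where
  "is_isometry V \<longleftrightarrow> adj V * V = 1\<^sub>m (dim_col V)"

definition iso_chan :: "complex mat \<Rightarrow> chan" where
  "iso_chan V = mk_chan (dim_col V) (dim_row V) (\<lambda>\<rho>. V * \<rho> * adj V)"

definition is_iso_channel :: "chan \<Rightarrow> bool" where
  "is_iso_channel N \<longleftrightarrow> din N > 0 \<and>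
     (\<exists>V. is_isometry V \<and> dim_col V = din N \<and> dim_row V = dout N \<and> N = iso_chan V)"

definition ch_comp :: "chan \<Rightarrow> chan \<Rightarrow> chan" where
  "ch_comp N M = mk_chan (din M) (dout N) (\<lambda>\<rho>. ch_apply N (ch_apply M \<rho>))"

definition id_chan :: "nat \<Rightarrow> chan" where
  "id_chan r = mk_chan r r id"

definition tensor_apply :: "chan \<Rightarrow> chan \<Rightarrow> complex mat \<Rightarrow> complex mat" where
  "tensor_apply N M \<rho> = mat (dout N * dout M) (dout N * dout M) (\<lambda>(i,j).
     \<Sum>a<din N. \<Sum>a'<din M. \<Sum>c<din N. \<Sum>c'<din M.
       \<rho> $$ (a * din M + a', c * din M + c')
       * choi_mat N $$ (a * dout N + i div dout M, c * dout N + j div dout M)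
       * choi_mat M $$ (a' * dout M + i mod dout M, c' * dout M + j mod dout M))"

definition ch_tensor :: "chan \<Rightarrow> chan \<Rightarrow> chan" where
  "ch_tensor N M = mk_chan (din N * din M) (dout N * dout M) (tensor_apply N M)"

text \<open>Superchannel realization (r, V, E): Theta[N] = E o (id_R (x) N) o V.\<close>
type_synonym realization = "nat \<times> chan \<times> chan"

definition super_apply :: "realization \<Rightarrow> chan \<Rightarrow> chan" where
  "super_apply R N = (case R of (r, V, E) \<Rightarrow> ch_comp E (ch_comp (ch_tensor (id_chan r) N) V))"

text \<open>Valid realization of a superchannel CPTP(A->B) -> CPTP(A'->B), |A|=m, |A'|=m', |B|=n.\<close>
definition valid_real :: "nat \<Rightarrow> nat \<Rightarrow> nat \<Rightarrow> realization \<Rightarrow> bool" where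
  "valid_real m m' n R = (case R of (r, V, E) \<Rightarrow>
     r > 0 \<and> is_iso_channel V \<and> din V = m' \<and> dout V = r * m \<and>
     is_channel E \<and> din E = r * n \<and> dout E = n)"

definition same_super :: "nat \<Rightarrow> nat \<Rightarrow> realization \<Rightarrow> realization \<Rightarrow> bool" where
  "same_super m n R R' \<longleftrightarrow>
     (\<forall>N. is_channel N \<and> din N = m \<and> dout N = n \<longrightarrow> super_apply R N = super_apply R' N)"

definition mixing_real :: "nat \<Rightarrow> nat \<Rightarrow> nat \<Rightarrow> realization \<Rightarrow> bool" where
  "mixing_real m m' n R \<longleftrightarrow> valid_real m m' n R \<and>
     (\<forall>R'. valid_real m m' n R' \<and> same_super m n R R' \<longrightarrow> fst R \<le> fst R') \<and>
     (\<forall>\<tau>. density (fst R) \<tau> \<longrightarrow> ch_apply (snd (snd R)) (kron \<tau> (unif n)) = unif n)"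

definition succ_same :: "chan \<Rightarrow> chan \<Rightarrow> bool" where
  "succ_same N M \<longleftrightarrow> dout N = dout M \<and>
     (\<exists>R. mixing_real (din N) (din M) (dout N) R \<and> M = super_apply R N)"

definition majorizes :: "chan \<Rightarrow> chan \<Rightarrow> bool" where
  "majorizes N M \<longleftrightarrow>
     (if dout N > dout M then
        (\<exists>U. is_iso_channel U \<and> din U = dout M \<and> dout U = dout N \<and> succ_same N (ch_comp U M))
      else
        (\<exists>W. is_iso_channel W \<and> din W = dout N \<and> dout W = dout M \<and> succ_same (ch_comp W N) M))"

definition state_chan :: "complex mat \<Rightarrow> chan" where
  "state_chan \<rho> = (1, dim_row \<rho>, \<rho>)"

definition channel_entropy :: "(chan \<Rightarrow> real) \<Rightarrow> bool" where
  "channel_entropy H \<longleftrightarrow>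
     (\<exists>N. is_channel N \<and> H N \<noteq> 0) \<and>
     (\<forall>N M. is_channel N \<and> is_channel M \<and> majorizes N M \<longrightarrow> H N \<le> H M) \<and>
     (\<forall>N M. is_channel N \<and> is_channel M \<longrightarrow> H (ch_tensor N M) = H N + H M) \<and>
     H (state_chan (unif 2)) = 1"

end

(*
  Let V have input dimension m and tensor it with the maximally mixed state of dimension m.  The
  Choi matrix of the resulting channel N is an orthogonal projection G of rank m, and this makes N
  equivalent to the pure state |0><0| of its output dimension n:

  * |0><0| majorizes N.  Keep the input as reference and test the n-dimensional system for |0>; on
    success apply N to the reference, otherwise the channel with Choi matrix (1 - G)/(n - 1).  On a
    uniform n-dimensional system the two cases average to the uniform output.
  * N majorizes |0><0|.  Feed half of a maximally entangled state into N and measure {G, 1 - G};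
    output |0><0| on success and (1 - |0><0|)/(n - 1) otherwise.

  Pure states have entropy 0, and additivity with monotonicity gives the uniform state of
  dimension m the entropy log m, so 0 = H(N) = H(V) + log m.
*)

theory Submission
  imports Defs "Jordan_Normal_Form.Determinant"
begin

subsection \<open>Channels given by their Choi kernels\<close>

text \<open>Complex-valued, so that contracting an index is one application of
  \<open>sum_delta_nat\<close> and needs no case distinction.\<close>

definition delta :: "nat \<Rightarrow> nat \<Rightarrow> complex" where
  "delta i j = (if i = j then 1 else 0)"

lemma delta_refl [simp]: "delta i i = 1"
  by (simp add: delta_def)

lemma delta_commute: "delta i j = delta j i"
  by (simp add: delta_def)

lemma cnj_delta [simp]: "cnj (delta i j) = delta i j"
  by (simp add: delta_def)

lemma sum_delta_nat [simp]:
  assumes "a < n"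
  shows "(\<Sum>i<n. delta a i * f i) = f a" "(\<Sum>i<n. delta i a * f i) = f a"
    "(\<Sum>i<n. f i * delta a i) = f a" "(\<Sum>i<n. f i * delta i a) = f a"
    "(\<Sum>i<n. delta a i) = 1" "(\<Sum>i<n. delta i a) = 1"
proof -
  have *: "(\<Sum>i<n. g i) = g a" if "\<And>i. i \<noteq> a \<Longrightarrow> g i = 0" for g :: "nat \<Rightarrow> complex"
    using that assms by (subst sum.remove[of _ a]) (auto intro!: sum.neutral)
  show "(\<Sum>i<n. delta a i * f i) = f a" by (subst *) (auto simp: delta_def)
  show "(\<Sum>i<n. delta i a * f i) = f a" by (subst *) (auto simp: delta_def)
  show "(\<Sum>i<n. f i * delta a i) = f a" by (subst *) (auto simp: delta_def)
  show "(\<Sum>i<n. f i * delta i a) = f a" by (subst *) (auto simp: delta_def)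
  show "(\<Sum>i<n. delta a i) = 1" by (subst *) (auto simp: delta_def)
  show "(\<Sum>i<n. delta i a) = 1" by (subst *) (auto simp: delta_def)
qed

section \<open>Composite indices of bipartite systems\<close>

lemma pair_index_less: "a < m \<Longrightarrow> b < n \<Longrightarrow> a * n + b < m * (n::nat)"
  using mult_le_mono1[of "Suc a" m n] by simp

lemma pair_index_eq_iff: "b < n \<Longrightarrow> a * n + b = k \<longleftrightarrow> a = k div n \<and> b = k mod (n::nat)"
  by auto

lemma delta_pair_index: "b < n \<Longrightarrow> delta (a * n + b) k = delta a (k div n) * delta b (k mod n)"
  by (simp add: delta_def pair_index_eq_iff)

lemma delta_div_mod: "delta (i div n) (j div n) * delta (i mod n) (j mod n) = delta i j"
  by (auto simp: delta_def) (metis div_mult_mod_eq)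

lemma sum_pair_index: "(\<Sum>i<m * n. f i) = (\<Sum>a<m. \<Sum>b<n. f (a * n + b :: nat) :: complex)"
proof -
  have "(\<Sum>b<n. f (a * n + b)) = sum f {a * n..<a * n + n}" for a
    by (rule sum.reindex_bij_witness[of _ "\<lambda>i. i - a * n" "\<lambda>b. a * n + b"]) auto
  then show ?thesis by (simp add: sum.nat_group)
qed

text \<open>The normal form for computing with channels: \<open>k a b c d\<close> stands for entry
  \<open>(b, d)\<close> of the image of |a><c|. Equality of two channels then reduces, through
  \<open>kernel_chan_cong\<close>, to equality of kernels on in-range indices.\<close>

definition kernel_chan :: "nat \<Rightarrow> nat \<Rightarrow> (nat \<Rightarrow> nat \<Rightarrow> nat \<Rightarrow> nat \<Rightarrow> complex) \<Rightarrow> chan" where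
  "kernel_chan m n k =
     (m, n, mat (m * n) (m * n) (\<lambda>(i,j). k (i div n) (i mod n) (j div n) (j mod n)))"

definition kernel :: "chan \<Rightarrow> nat \<Rightarrow> nat \<Rightarrow> nat \<Rightarrow> nat \<Rightarrow> complex" where
  "kernel N a b c d = choi_mat N $$ (a * dout N + b, c * dout N + d)"

lemma din_kernel_chan [simp]: "din (kernel_chan m n k) = m"
  and dout_kernel_chan [simp]: "dout (kernel_chan m n k) = n"
  and choi_kernel_chan: "choi_mat (kernel_chan m n k) =
    mat (m * n) (m * n) (\<lambda>(i,j). k (i div n) (i mod n) (j div n) (j mod n))"
  by (simp_all add: kernel_chan_def din_def dout_def choi_mat_def)

lemma div_mod_bounds:
  assumes "i < m * (n::nat)" shows "i div n < m" "i mod n < n"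
  using assms by (cases "n = 0"; simp add: less_mult_imp_div_less)+

lemma kernel_kernel_chan [simp]:
  "a < m \<Longrightarrow> b < n \<Longrightarrow> c < m \<Longrightarrow> d < n \<Longrightarrow> kernel (kernel_chan m n k) a b c d = k a b c d"
  by (simp add: kernel_def choi_kernel_chan pair_index_less)

lemma kernel_chan_cong:
  assumes "\<And>a b c d. a < m \<Longrightarrow> b < n \<Longrightarrow> c < m \<Longrightarrow> d < n \<Longrightarrow> k a b c d = k' a b c d"
  shows "kernel_chan m n k = kernel_chan m n k'"
  unfolding kernel_chan_def by (auto intro!: eq_matI assms simp: div_mod_bounds)

lemma kernel_chan_kernel:
  assumes "choi_mat N \<in> carrier_mat (din N * dout N) (din N * dout N)"
  shows "kernel_chan (din N) (dout N) (kernel N) = N"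
proof -
  have "mat (din N * dout N) (din N * dout N)
     (\<lambda>(i,j). kernel N (i div dout N) (i mod dout N) (j div dout N) (j mod dout N)) = choi_mat N"
    using assms by (auto intro!: eq_matI simp: kernel_def)
  then show ?thesis
    unfolding kernel_chan_def by (simp add: din_def dout_def choi_mat_def)
qed

lemma kernel_chan_kernel_channel: "is_channel N \<Longrightarrow> kernel_chan (din N) (dout N) (kernel N) = N"
  by (simp add: is_channel_def kernel_chan_kernel)

section \<open>Choi kernels of the basic constructions\<close>

lemma mk_chan_eq: "mk_chan m n f = kernel_chan m n (\<lambda>a b c d. f (munit m a c) $$ (b, d))"
  by (simp add: mk_chan_def kernel_chan_def choi_def)

lemma id_chan_eq: "id_chan r = kernel_chan r r (\<lambda>a b c d. delta a b * delta c d)"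
  unfolding id_chan_def mk_chan_eq
  by (rule kernel_chan_cong) (auto simp: munit_def delta_def)

lemma iso_chan_eq:
  "iso_chan V = kernel_chan (dim_col V) (dim_row V) (\<lambda>a b c d. V $$ (b, a) * cnj (V $$ (d, c)))"
  unfolding iso_chan_def mk_chan_eq
proof (rule kernel_chan_cong)
  fix a b c d assume *: "a < dim_col V" "b < dim_row V" "c < dim_col V" "d < dim_row V"
  have "(V * munit (dim_col V) a c * adj V) $$ (b, d)
      = (\<Sum>j<dim_col V. (\<Sum>i<dim_col V. V $$ (b, i) * (delta i a * delta j c)) * cnj (V $$ (d, j)))"
    using * by (simp add: munit_def adj_def scalar_prod_def atLeast0LessThan)
      (intro sum.cong refl arg_cong2[where f = "(*)"], auto simp: delta_def)
  also have "\<dots> = V $$ (b, a) * cnj (V $$ (d, c))"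
    using * by (simp flip: mult.assoc sum_distrib_right) (simp add: mult.assoc flip: sum_distrib_left)
  finally show "(V * munit (dim_col V) a c * adj V) $$ (b, d) = V $$ (b, a) * cnj (V $$ (d, c))" .
qed

lemma state_chan_eq:
  "\<rho> \<in> carrier_mat n n \<Longrightarrow> state_chan \<rho> = kernel_chan 1 n (\<lambda>a b c d. \<rho> $$ (b, d))"
  by (auto simp: state_chan_def kernel_chan_def intro!: eq_matI)

lemma unif_chan_eq:
  "state_chan (unif n) = kernel_chan 1 n (\<lambda>a b c d. delta b d / of_nat n)"
  by (subst state_chan_eq[of _ n]) (auto simp: unif_def delta_def intro!: kernel_chan_cong)

lemma ch_apply_munit:
  assumes "a < din M" "c < din M" "b < dout M" "d < dout M"
  shows "ch_apply M (munit (din M) a c) $$ (b, d) = kernel M a b c d"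
proof -
  have "ch_apply M (munit (din M) a c) $$ (b, d) =
     (\<Sum>x<din M. \<Sum>y<din M. delta x a * (delta y c * kernel M x b y d))"
    using assms by (auto simp: ch_apply_def munit_def delta_def kernel_def intro!: sum.cong)
  then show ?thesis using assms by (simp flip: sum_distrib_left)
qed

text \<open>Contracting the shared system is the link product of the two Choi matrices. No index is
  transposed or conjugated here, which decides the form of the measurements used later.\<close>

lemma ch_comp_eq:
  assumes "dout M = din N"
  shows "ch_comp N M = kernel_chan (din M) (dout N)
    (\<lambda>a b c d. \<Sum>x<din N. \<Sum>y<din N. kernel M a x c y * kernel N x b y d)"
  unfolding ch_comp_def mk_chan_eq
proof (rule kernel_chan_cong)
  fix a b c d assume "a < din M" "b < dout N" "c < din M" "d < dout N"
  then show "ch_apply N (ch_apply M (munit (din M) a c)) $$ (b, d) =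
       (\<Sum>x<din N. \<Sum>y<din N. kernel M a x c y * kernel N x b y d)"
    using assms ch_apply_munit[of a M c]
    by (simp add: ch_apply_def[of N] kernel_def[of N])
qed

lemma ch_tensor_eq:
  "ch_tensor N M = kernel_chan (din N * din M) (dout N * dout M)
    (\<lambda>a b c d. kernel N (a div din M) (b div dout M) (c div din M) (d div dout M)
             * kernel M (a mod din M) (b mod dout M) (c mod din M) (d mod dout M))"
  unfolding ch_tensor_def mk_chan_eq
proof (rule kernel_chan_cong)
  fix A b C d assume *: "A < din N * din M" "b < dout N * dout M" "C < din N * din M" "d < dout N * dout M"
  note bounds = div_mod_bounds[OF *(1)] div_mod_bounds[OF *(3)]
  have "tensor_apply N M (munit (din N * din M) A C) $$ (b, d) =
     (\<Sum>a<din N. \<Sum>a'<din M. \<Sum>c<din N. \<Sum>c'<din M.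
       delta (a * din M + a') A * delta (c * din M + c') C
       * kernel N a (b div dout M) c (d div dout M) * kernel M a' (b mod dout M) c' (d mod dout M))"
    unfolding tensor_apply_def using *
    by simp (intro sum.cong refl, simp add: munit_def delta_def kernel_def pair_index_less)
  also have "\<dots> = (\<Sum>a<din N. delta a (A div din M) * (\<Sum>a'<din M. delta a' (A mod din M) *
     (\<Sum>c<din N. delta c (C div din M) * (\<Sum>c'<din M. delta c' (C mod din M)
       * (kernel N a (b div dout M) c (d div dout M) * kernel M a' (b mod dout M) c' (d mod dout M))))))"
    unfolding sum_distrib_left
    by (intro sum.cong refl) (simp add: delta_pair_index)
  also have "\<dots> = kernel N (A div din M) (b div dout M) (C div din M) (d div dout M)
             * kernel M (A mod din M) (b mod dout M) (C mod din M) (d mod dout M)"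
    using bounds by simp
  finally show "tensor_apply N M (munit (din N * din M) A C) $$ (b, d) = \<dots>" .
qed

lemma is_channel_kernel_chan:
  "is_channel (kernel_chan m n k) \<longleftrightarrow> m > 0 \<and> n > 0 \<and> psd (choi_mat (kernel_chan m n k)) \<and>
     (\<forall>a<m. \<forall>c<m. (\<Sum>b<n. k a b c b) = delta a c)"
  by (auto simp: is_channel_def choi_kernel_chan delta_def pair_index_less)

text \<open>The quadratic form at \<open>v\<close> becomes a sum of \<open>w t\<close> times the
  squared modulus of the inner product of \<open>v\<close> with \<open>u t\<close>. Every positivity
  proof below goes through such a Gram decomposition.\<close>

lemma psd_gramI:
  assumes A: "A \<in> carrier_mat n n" and w: "\<And>t. t \<in> T \<Longrightarrow> w t \<ge> 0"
    and gram: "\<And>i j. i < n \<Longrightarrow> j < n \<Longrightarrow>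
      A $$ (i, j) = (\<Sum>t\<in>T. complex_of_real (w t) * (u t i * cnj (u t j)))"
  shows "psd A"
  unfolding psd_def
proof (intro conjI ballI)
  show "A \<in> carrier_mat (dim_row A) (dim_row A)" using A by auto
  fix v :: "complex vec"
  define s where "s t = (\<Sum>i<n. cnj (v $ i) * u t i)" for t
  have "(\<Sum>i<n. \<Sum>j<n. cnj (v $ i) * A $$ (i, j) * v $ j)
     = (\<Sum>i<n. \<Sum>j<n. \<Sum>t\<in>T. w t * (cnj (v $ i) * u t i * cnj (cnj (v $ j) * u t j)))"
    by (simp add: gram sum_distrib_left sum_distrib_right mult_ac)
  also have "\<dots> = (\<Sum>i<n. \<Sum>t\<in>T. \<Sum>j<n. w t * (cnj (v $ i) * u t i * cnj (cnj (v $ j) * u t j)))"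
    by (intro sum.cong refl sum.swap)
  also have "\<dots> = (\<Sum>t\<in>T. \<Sum>i<n. \<Sum>j<n. w t * (cnj (v $ i) * u t i * cnj (cnj (v $ j) * u t j)))"
    by (rule sum.swap)
  also have "\<dots> = (\<Sum>t\<in>T. w t * (s t * cnj (s t)))"
    unfolding s_def cnj_sum sum_product by (simp only: sum_distrib_left)
  also have "\<dots> = complex_of_real (\<Sum>t\<in>T. w t * (cmod (s t))\<^sup>2)"
    by (simp only: complex_norm_square[symmetric] of_real_sum of_real_mult)
  finally show "\<exists>r\<ge>0. (\<Sum>i<dim_row A. \<Sum>j<dim_row A. cnj (v $ i) * A $$ (i, j) * v $ j) = complex_of_real r"
    using A w by (intro exI[of _ "\<Sum>t\<in>T. w t * (cmod (s t))\<^sup>2"]) (auto intro!: sum_nonneg)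
qed


subsection \<open>Positivity from projections\<close>

text \<open>The single equation \<open>P P\<^sup>* = P\<close> already makes \<open>P\<close> Hermitian, hence an orthogonal projection.\<close>

definition gram_projection :: "nat \<Rightarrow> (nat \<Rightarrow> nat \<Rightarrow> complex) \<Rightarrow> bool" where
  "gram_projection k P \<longleftrightarrow> (\<forall>i<k. \<forall>j<k. (\<Sum>t<k. P i t * cnj (P j t)) = P i j)"

lemma gram_projection_hermitian:
  assumes "gram_projection k P" "i < k" "j < k"
  shows "cnj (P i j) = P j i"
proof -
  have "cnj (P i j) = (\<Sum>t<k. P j t * cnj (P i t))"
    using assms by (simp flip: gram_projection_def[THEN iffD1, rule_format, of k P i j] add: mult_ac)
  then show ?thesis using assms by (simp add: gram_projection_def)
qed

lemma gram_projection_cnj: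
  assumes "gram_projection k P"
  shows "gram_projection k (\<lambda>i j. cnj (P i j))"
  unfolding gram_projection_def
proof (intro allI impI)
  fix i j assume "i < k" "j < k"
  then have "cnj (\<Sum>t<k. P i t * cnj (P j t)) = cnj (P i j)"
    using assms by (simp add: gram_projection_def)
  then show "(\<Sum>t<k. cnj (P i t) * cnj (cnj (P j t))) = cnj (P i j)" by simp
qed

lemma psd_projection:
  assumes "A \<in> carrier_mat k k" "gram_projection k (\<lambda>i j. A $$ (i, j))"
  shows "psd A"
  by (rule psd_gramI[OF assms(1), of "{..<k}" "\<lambda>_. 1" "\<lambda>t i. A $$ (i, t)"])
    (use assms(2) in \<open>auto simp: gram_projection_def\<close>)

text \<open>Sorted by the label \<open>q\<close>, the matrix is block diagonal: \<open>P\<close> for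
  label 0 and \<open>c\<close> times the complementary projection for every other label. The maps
  \<open>p\<close> and \<open>q\<close> stay abstract because the Choi indices of
  \<open>measure_chan\<close> and \<open>prepare_chan\<close> interleave the label with the index of
  \<open>P\<close> differently.\<close>

lemma psd_controlled_projection:
  fixes p q :: "nat \<Rightarrow> nat"
  assumes A: "A \<in> carrier_mat N N" and P: "gram_projection k P" and c: "c \<ge> 0"
    and p: "\<And>i. i < N \<Longrightarrow> p i < k" and q: "\<And>i. i < N \<Longrightarrow> q i < n"
    and entries: "\<And>i j. i < N \<Longrightarrow> j < N \<Longrightarrow> A $$ (i, j) =
      (if q i = q j then if q i = 0 then P (p i) (p j)
         else complex_of_real c * (delta (p i) (p j) - P (p i) (p j)) else 0)"
  shows "psd A"
proof (rule psd_gramI[OF A])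
  \<comment> \<open>The Gram vectors are the columns of \<open>P\<close> in the block of label 0 and
    the columns of \<open>1 - P\<close> in every other block \<open>s\<close>; the weight carries
    the factor \<open>c\<close>.\<close>
  define w where "w = (\<lambda>(t::nat, s::nat). if s = 0 then 1 else c)"
  define u where "u = (\<lambda>(t, s) i. delta (q i) s *
    (if s = 0 then P (p i) t else delta (p i) t - P (p i) t))"
  show "0 \<le> w t" if "t \<in> {..<k} \<times> {..<n}" for t
    using c by (auto simp: w_def split: prod.splits)
  fix i j assume ij: "i < N" "j < N"
  note pq = p[OF ij(1)] p[OF ij(2)] q[OF ij(1)] q[OF ij(2)]
  \<comment> \<open>\<open>h s t\<close> is the weighted summand within block \<open>s\<close>. Its
    sum over \<open>t\<close> is evaluated from the fact that \<open>P\<close> and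
    \<open>1 - P\<close> are both orthogonal projections.\<close>
  define h where "h s t = (if s = 0 then P (p i) t * cnj (P (p j) t)
    else complex_of_real c * ((delta (p i) t - P (p i) t) * (delta (p j) t - cnj (P (p j) t))))" for s t :: nat
  have h: "(\<Sum>t<k. h s t) = (if s = 0 then P (p i) (p j)
      else complex_of_real c * (delta (p i) (p j) - P (p i) (p j)))" for s
  proof (cases "s = 0")
    case True
    then show ?thesis using P pq by (simp add: h_def gram_projection_def)
  next
    case False
    then show ?thesis
      using P pq gram_projection_hermitian[OF P, of "p j" "p i"]
      by (simp add: h_def gram_projection_def algebra_simps sum.distrib sum_subtractf
          flip: sum_distrib_left) (simp add: delta_commute)
  qed
  have "(\<Sum>x\<in>{..<k} \<times> {..<n}. complex_of_real (w x) * (u x i * cnj (u x j)))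
      = (\<Sum>t<k. \<Sum>s<n. delta (q i) s * (delta (q j) s * h s t))"
    by (simp add: sum.cartesian_product)
      (intro sum.cong refl, auto simp: w_def u_def h_def algebra_simps)
  also have "\<dots> = (\<Sum>t<k. delta (q j) (q i) * h (q i) t)"
    using pq by simp
  also have "\<dots> = A $$ (i, j)"
    using ij by (simp add: h entries delta_def flip: sum_distrib_left)
  finally show "A $$ (i, j) = (\<Sum>x\<in>{..<k} \<times> {..<n}. complex_of_real (w x) * (u x i * cnj (u x j)))"
    by simp
qed

subsection \<open>Isometries and mixing superchannels\<close>

lemma isometry_entries:
  assumes "is_isometry V" "a < dim_col V" "c < dim_col V"
  shows "(\<Sum>b<dim_row V. V $$ (b, a) * cnj (V $$ (b, c))) = delta a c"
proof -
  have "(adj V * V) $$ (c, a) = delta a c"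
    using assms by (simp add: is_isometry_def delta_def)
  then show ?thesis
    using assms by (simp add: adj_def scalar_prod_def atLeast0LessThan mult_ac)
qed

lemma isometryI:
  assumes "\<And>a c. a < dim_col V \<Longrightarrow> c < dim_col V \<Longrightarrow>
    (\<Sum>b<dim_row V. V $$ (b, a) * cnj (V $$ (b, c))) = delta a c"
  shows "is_isometry V"
  unfolding is_isometry_def
  by (rule eq_matI) (auto simp: adj_def scalar_prod_def atLeast0LessThan mult.commute[of "cnj _"]
      assms delta_def)

text \<open>If \<open>n < m\<close>, padding \<open>V\<close> with zero rows and its adjoint with
  zero columns gives square matrices with \<open>U * W = 1\<close>. A one-sided inverse of a square
  matrix is two-sided, but row \<open>n\<close> of \<open>W\<close> vanishes, so
  \<open>W * U\<close> cannot be the identity.\<close>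

lemma isometry_dim_le:
  assumes "is_isometry V"
  shows "dim_col V \<le> dim_row V"
proof (rule ccontr)
  define m n where "m = dim_col V" and "n = dim_row V"
  assume "\<not> dim_col V \<le> dim_row V"
  then have nm: "n < m" by (simp add: m_def n_def)
  define W where "W = mat m m (\<lambda>(i, j). if i < n then V $$ (i, j) else 0)"
  define U where "U = mat m m (\<lambda>(i, j). if j < n then cnj (V $$ (j, i)) else 0)"
  have "U * W = 1\<^sub>m m"
  proof (rule eq_matI)
    fix a c assume "a < dim_row (1\<^sub>m m :: complex mat)" "c < dim_col (1\<^sub>m m :: complex mat)"
    then have ac: "a < m" "c < m" by auto
    have "(U * W) $$ (a, c) = (\<Sum>b<m. if b < n then V $$ (b, c) * cnj (V $$ (b, a)) else 0)"
      using ac by (simp add: U_def W_def scalar_prod_def atLeast0LessThan) (intro sum.cong refl, simp)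
    also have "\<dots> = (\<Sum>b<n. V $$ (b, c) * cnj (V $$ (b, a)))"
      using nm by (intro sum.mono_neutral_cong_right) auto
    also have "\<dots> = delta c a"
      using isometry_entries[OF assms, of c a] ac by (simp add: m_def n_def)
    finally show "(U * W) $$ (a, c) = 1\<^sub>m m $$ (a, c)" using ac by (simp add: delta_def)
  qed (auto simp: U_def W_def)
  then have "W * U = 1\<^sub>m m"
    by (rule mat_mult_left_right_inverse[rotated 2]) (auto simp: U_def W_def)
  moreover have "(W * U) $$ (n, n) = 0"
    using nm by (simp add: U_def W_def scalar_prod_def)
  ultimately show False using nm by simp
qed

lemma iso_channel_dim_le: "is_iso_channel V \<Longrightarrow> din V \<le> dout V"
  unfolding is_iso_channel_def using isometry_dim_le by metis

lemma is_channel_iso_channel: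
  assumes "is_iso_channel V"
  shows "is_channel V"
proof -
  from assms obtain W where W: "is_isometry W" "dim_col W > 0" "V = iso_chan W"
    by (auto simp: is_iso_channel_def)
  have "psd (choi_mat (iso_chan W))"
    \<comment> \<open>The Choi matrix of an isometry has rank one; its single Gram vector is the
      vectorised isometry.\<close>
    by (rule psd_gramI[of _ "dim_col W * dim_row W" "{()}" "\<lambda>_. 1"
          "\<lambda>_ i. W $$ (i mod dim_row W, i div dim_row W)"])
      (auto simp: iso_chan_eq choi_kernel_chan)
  moreover have "dim_row W > 0" using isometry_dim_le[OF W(1)] W(2) by simp
  ultimately show ?thesis
    using W isometry_entries[OF W(1)] unfolding W(3) iso_chan_eq is_channel_kernel_chan by auto
qed

lemma is_iso_channelI:
  assumes "is_isometry V" "dim_col V > 0"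
  shows "is_iso_channel (iso_chan V)"
  using assms by (auto simp: is_iso_channel_def iso_chan_eq)

lemma id_chan_iso_chan: "id_chan n = iso_chan (1\<^sub>m n)"
  unfolding id_chan_eq iso_chan_eq by (auto intro!: kernel_chan_cong simp: delta_def)

lemma is_iso_channel_id: "n > 0 \<Longrightarrow> is_iso_channel (id_chan n)"
  unfolding id_chan_iso_chan
  by (intro is_iso_channelI) (auto simp: is_isometry_def adj_def intro!: eq_matI)

section \<open>Identity laws and superchannels with identity preprocessing\<close>

lemma din_id [simp]: "din (id_chan n) = n" and dout_id [simp]: "dout (id_chan n) = n"
  by (simp_all add: id_chan_eq)

lemma din_comp [simp]: "din (ch_comp N M) = din M" and dout_comp [simp]: "dout (ch_comp N M) = dout N"
  by (simp_all add: ch_comp_def mk_chan_def din_def dout_def)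

lemma choi_comp_carrier:
  "choi_mat (ch_comp N M) \<in> carrier_mat (din M * dout N) (din M * dout N)"
  by (simp add: ch_comp_def mk_chan_def choi_def choi_mat_def)

lemma channel_carrier: "is_channel N \<Longrightarrow> choi_mat N \<in> carrier_mat (din N * dout N) (din N * dout N)"
  by (simp add: is_channel_def)

lemma channel_pos: "is_channel N \<Longrightarrow> 0 < din N" "is_channel N \<Longrightarrow> 0 < dout N"
  by (simp_all add: is_channel_def)

lemma channel_trace:
  "is_channel N \<Longrightarrow> a < din N \<Longrightarrow> c < din N \<Longrightarrow> (\<Sum>b<dout N. kernel N a b c b) = delta a c"
  by (simp add: is_channel_def kernel_def delta_def)

lemma ch_comp_id_left:
  assumes "choi_mat N \<in> carrier_mat (din N * dout N) (din N * dout N)"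
  shows "ch_comp (id_chan (dout N)) N = N"
proof -
  have "ch_comp (id_chan (dout N)) N = kernel_chan (din N) (dout N) (kernel N)"
    by (subst ch_comp_eq) (auto simp: id_chan_eq simp flip: mult.assoc sum_distrib_right
      intro!: kernel_chan_cong)
  then show ?thesis by (simp add: kernel_chan_kernel[OF assms])
qed

lemma ch_comp_id_right:
  assumes "choi_mat N \<in> carrier_mat (din N * dout N) (din N * dout N)"
  shows "ch_comp N (id_chan (din N)) = N"
proof -
  have "ch_comp N (id_chan (din N)) = kernel_chan (din N) (dout N) (kernel N)"
    by (subst ch_comp_eq) (auto simp: id_chan_eq mult.assoc simp flip: sum_distrib_left
      intro!: kernel_chan_cong)
  then show ?thesis by (simp add: kernel_chan_kernel[OF assms])
qed

lemma ch_tensor_id_one: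
  assumes "choi_mat N \<in> carrier_mat (din N * dout N) (din N * dout N)"
  shows "ch_tensor (id_chan 1) N = N"
proof -
  have "ch_tensor (id_chan 1) N = kernel_chan (din N) (dout N) (kernel N)"
    by (auto simp: ch_tensor_eq id_chan_eq intro!: kernel_chan_cong)
  then show ?thesis by (simp add: kernel_chan_kernel[OF assms])
qed

lemma super_apply_one:
  assumes "choi_mat N \<in> carrier_mat (din N * dout N) (din N * dout N)"
  shows "super_apply (1, V, E) N = ch_comp E (ch_comp N V)"
  by (simp only: super_apply_def prod.case ch_tensor_id_one[OF assms])

text \<open>With the identity as preprocessing isometry, the input itself contains the reference:
  \<open>a div din N\<close> reaches \<open>E\<close> untouched, while \<open>a mod din N\<close>
  passes through \<open>N\<close>.\<close>

lemma super_apply_id: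
  assumes "din E = r * dout N"
  shows "super_apply (r, id_chan (r * din N), E) N = kernel_chan (r * din N) (dout E)
    (\<lambda>a b c d. \<Sum>x<dout N. \<Sum>y<dout N. kernel N (a mod din N) x (c mod din N) y
       * kernel E ((a div din N) * dout N + x) b ((c div din N) * dout N + y) d)"
proof -
  let ?T = "ch_tensor (id_chan r) N"
  have dims: "din ?T = r * din N" "dout ?T = r * dout N"
    and carrier: "choi_mat ?T \<in> carrier_mat (din ?T * dout ?T) (din ?T * dout ?T)"
    by (simp_all add: ch_tensor_eq choi_kernel_chan)
  have "super_apply (r, id_chan (r * din N), E) N = ch_comp E ?T"
    using ch_comp_id_right[OF carrier] by (simp add: super_apply_def dims)
  also have "\<dots> = kernel_chan (r * din N) (dout E)
    (\<lambda>a b c d. \<Sum>x<r * dout N. \<Sum>y<r * dout N. kernel ?T a x c y * kernel E x b y d)"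
    using assms by (subst ch_comp_eq) (simp_all add: dims)
  also have "\<dots> = kernel_chan (r * din N) (dout E)
    (\<lambda>a b c d. \<Sum>x<dout N. \<Sum>y<dout N. kernel N (a mod din N) x (c mod din N) y
       * kernel E ((a div din N) * dout N + x) b ((c div din N) * dout N + y) d)"
  proof (rule kernel_chan_cong)
    fix a b c d assume *: "a < r * din N" "c < r * din N"
    note bounds = div_mod_bounds[OF *(1)] div_mod_bounds[OF *(2)]
    have "(\<Sum>x<r * dout N. \<Sum>y<r * dout N. kernel ?T a x c y * kernel E x b y d)
      = (\<Sum>i<r. \<Sum>x<dout N. \<Sum>j<r. \<Sum>y<dout N. delta (a div din N) i * (delta (c div din N) j *
          (kernel N (a mod din N) x (c mod din N) y
            * kernel E (i * dout N + x) b (j * dout N + y) d)))"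
      using * bounds unfolding sum_pair_index
      by (intro sum.cong refl) (simp add: ch_tensor_eq id_chan_eq pair_index_less)
    also have "\<dots> = (\<Sum>x<dout N. \<Sum>y<dout N. kernel N (a mod din N) x (c mod din N) y
       * kernel E ((a div din N) * dout N + x) b ((c div din N) * dout N + y) d)"
      using bounds by (simp flip: sum_distrib_left)
    finally show "(\<Sum>x<r * dout N. \<Sum>y<r * dout N. kernel ?T a x c y * kernel E x b y d) = \<dots>" .
  qed
  finally show ?thesis .
qed

text \<open>The mixing condition is linear in the reference state, so it suffices to test it on the
  matrix units |x><y|. The sum in the hypothesis is the image of |x><y| tensored with the identity;
  the trace of \<open>\<tau>\<close> does the rest.\<close>

lemma mixing_kernel:
  assumes \<tau>: "density r \<tau>" and n: "n > 0"
    and e: "\<And>x y b d. x < r \<Longrightarrow> y < r \<Longrightarrow> b < n \<Longrightarrow> d < n \<Longrightarrow>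
      (\<Sum>i<n. kernel E (x * n + i) b (y * n + i) d) = delta x y * delta b d"
    and dims: "din E = r * n" "dout E = n"
  shows "ch_apply E (kron \<tau> (unif n)) = unif n"
proof (rule eq_matI)
  fix b d assume "b < dim_row (unif n)" "d < dim_col (unif n)"
  then have bd: "b < n" "d < n" by (auto simp: unif_def)
  have \<tau>': "\<tau> \<in> carrier_mat r r" "(\<Sum>x<r. \<tau> $$ (x, x)) = 1"
    using \<tau> by (auto simp: density_def mtrace_def)
  have "ch_apply E (kron \<tau> (unif n)) $$ (b, d)
    = (\<Sum>x<r. \<Sum>i<n. \<Sum>y<r. \<Sum>j<n. delta i j * (\<tau> $$ (x, y) / of_nat n
        * kernel E (x * n + i) b (y * n + j) d))"
    using bd \<tau>' unfolding ch_apply_def kernel_def dims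
    by (simp add: sum_pair_index) (intro sum.cong refl,
      simp add: kron_def unif_def pair_index_less delta_def)
  also have "\<dots> = (\<Sum>x<r. \<Sum>i<n. \<Sum>y<r. \<tau> $$ (x, y) / of_nat n * kernel E (x * n + i) b (y * n + i) d)"
    by (intro sum.cong refl) (simp del: times_divide_eq_left)
  also have "\<dots> = (\<Sum>x<r. \<Sum>y<r. \<Sum>i<n. \<tau> $$ (x, y) / of_nat n * kernel E (x * n + i) b (y * n + i) d)"
    by (intro sum.cong refl sum.swap)
  also have "\<dots> = (\<Sum>x<r. \<Sum>y<r. delta x y * (\<tau> $$ (x, y) / of_nat n * delta b d))"
    unfolding sum_distrib_left[symmetric] using bd by (intro sum.cong refl) (simp add: e)
  also have "\<dots> = (\<Sum>x<r. \<tau> $$ (x, x)) / of_nat n * delta b d"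
    by (simp add: sum_divide_distrib sum_distrib_right del: times_divide_eq_left times_divide_eq_right)
  finally show "ch_apply E (kron \<tau> (unif n)) $$ (b, d) = unif n $$ (b, d)"
    using bd \<tau>' by (simp add: unif_def delta_def)
qed (use dims in \<open>auto simp: ch_apply_def unif_def\<close>)

text \<open>Minimality of the reference dimension \<open>r\<close> is automatic when \<open>m' = r * m\<close>: any competitor
  isometry from \<open>m'\<close> to \<open>r' * m\<close> dimensions forces \<open>m' \<le> r' * m\<close>.\<close>

lemma mixing_realI:
  assumes "is_iso_channel V" "din V = m'" "dout V = r * m" "r = 1 \<or> m' = r * m"
    and "is_channel E" "din E = r * n" "dout E = n"
    and "\<And>x y b d. x < r \<Longrightarrow> y < r \<Longrightarrow> b < n \<Longrightarrow> d < n \<Longrightarrow>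
      (\<Sum>i<n. kernel E (x * n + i) b (y * n + i) d) = delta x y * delta b d"
  shows "mixing_real m m' n (r, V, E)"
proof -
  have n: "n > 0" and "r * n > 0"
    using channel_pos[of E] assms(5-7) by auto
  then have r: "r > 0" by auto
  have min: "r \<le> r'" if "valid_real m m' n (r', V', E')" for r' V' E'
    using assms(4)
  proof
    assume "r = 1" then show ?thesis using that by (auto simp: valid_real_def)
  next
    assume m': "m' = r * m"
    have "m' \<le> r' * m" using that iso_channel_dim_le[of V'] by (auto simp: valid_real_def)
    moreover have "m > 0" using assms(1,2) m' by (auto simp: is_iso_channel_def)
    ultimately show ?thesis using m' by simp
  qed
  have "valid_real m m' n (r, V, E)" using r assms by (simp add: valid_real_def)
  moreover have "ch_apply E (kron \<tau> (unif n)) = unif n" if "density r \<tau>" for \<tau>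
    using mixing_kernel[OF that n] assms by simp
  ultimately show ?thesis using min by (auto simp: mixing_real_def)
qed

text \<open>A trivial reference with identity postprocessing is mixing, because the identity fixes
  the uniform state. This covers reflexivity and the feeding of a pure state into a channel.\<close>

lemma succ_same_precomp:
  assumes N: "choi_mat N \<in> carrier_mat (din N * dout N) (din N * dout N)" "0 < dout N"
    and V: "is_iso_channel V" "dout V = din N"
  shows "succ_same N (ch_comp N V)"
proof -
  have "mixing_real (din N) (din V) (dout N) (1, V, id_chan (dout N))"
    using assms
    by (intro mixing_realI is_channel_iso_channel is_iso_channel_id) (auto simp: id_chan_eq)
  moreover have "super_apply (1, V, id_chan (dout N)) N = ch_comp N V"
    using ch_comp_id_left[of "ch_comp N V"] by (simp add: super_apply_one[OF N(1), simplified] choi_comp_carrier)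
  ultimately show ?thesis unfolding succ_same_def by (intro conjI exI[of _ "(1, V, id_chan (dout N))"]) auto
qed

lemma succ_same_refl:
  assumes "choi_mat N \<in> carrier_mat (din N * dout N) (din N * dout N)" "0 < din N" "0 < dout N"
  shows "succ_same N N"
  using succ_same_precomp[OF assms(1,3) is_iso_channel_id[OF assms(2)]] ch_comp_id_right[OF assms(1)]
  by simp

lemma majorizes_same_output:
  assumes "succ_same N M" "is_channel N"
  shows "majorizes N M"
proof -
  have "dout N = dout M" using assms(1) by (simp add: succ_same_def)
  moreover have "is_iso_channel (id_chan (dout N))"
    using assms(2) by (intro is_iso_channel_id channel_pos)
  ultimately show ?thesis
    using assms(1) ch_comp_id_left[OF channel_carrier[OF assms(2)]]
    unfolding majorizes_def by (metis din_id dout_id less_irrefl)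
qed

text \<open>The reference is taken as part of the input of \<open>M\<close> and the preprocessing is
  the identity, so minimality is a dimension count. What remains for each application is the mixing
  condition on matrix units and one identity of kernels.\<close>

lemma majorizes_reference:
  assumes "is_channel N" "is_channel M" "r * din N = din M" "dout N = dout M"
    and "is_channel E" "din E = r * dout N" "dout E = dout N"
    and "\<And>x y b d. x < r \<Longrightarrow> y < r \<Longrightarrow> b < dout N \<Longrightarrow> d < dout N \<Longrightarrow>
      (\<Sum>i<dout N. kernel E (x * dout N + i) b (y * dout N + i) d) = delta x y * delta b d"
    and "\<And>a b c d. a < din M \<Longrightarrow> b < dout M \<Longrightarrow> c < din M \<Longrightarrow> d < dout M \<Longrightarrow> kernel M a b c d =
      (\<Sum>x<dout N. \<Sum>y<dout N. kernel N (a mod din N) x (c mod din N) y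
       * kernel E ((a div din N) * dout N + x) b ((c div din N) * dout N + y) d)"
  shows "majorizes N M"
proof (rule majorizes_same_output)
  have "mixing_real (din N) (din M) (dout N) (r, id_chan (r * din N), E)"
    using assms channel_pos[OF assms(2)] by (intro mixing_realI) (auto intro!: is_iso_channel_id)
  moreover have "super_apply (r, id_chan (r * din N), E) N = kernel_chan (din M) (dout M) (kernel M)"
    unfolding super_apply_id[OF assms(6)] using assms(3,4,7)
    by (auto intro!: kernel_chan_cong simp: assms(9))
  ultimately show "succ_same N M"
    using assms kernel_chan_kernel_channel[OF assms(2)] unfolding succ_same_def by metis
qed fact

subsection \<open>Pure states\<close>

definition pure_chan :: "nat \<Rightarrow> chan" where
  "pure_chan n = kernel_chan 1 n (\<lambda>a b c d. delta b 0 * delta d 0)"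

lemma din_pure [simp]: "din (pure_chan n) = 1" and dout_pure [simp]: "dout (pure_chan n) = n"
  by (simp_all add: pure_chan_def)

lemma kernel_pure: "b < n \<Longrightarrow> d < n \<Longrightarrow> kernel (pure_chan n) 0 b 0 d = delta b 0 * delta d 0"
  by (simp add: pure_chan_def)

text \<open>A unit vector is an isometry with one column. It is used for |0> and for the maximally
  entangled vector.\<close>

lemma is_iso_channel_vector:
  assumes "(\<Sum>b<n. v b * cnj (v b)) = 1"
  shows "is_iso_channel (kernel_chan 1 n (\<lambda>a b c d. v b * cnj (v d)))"
proof -
  let ?V = "mat n 1 (\<lambda>(i, j). v i)"
  have "is_isometry ?V" using assms by (intro isometryI) simp
  moreover have "kernel_chan 1 n (\<lambda>a b c d. v b * cnj (v d)) = iso_chan ?V"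
    unfolding iso_chan_eq by (simp, intro kernel_chan_cong) simp
  ultimately show ?thesis using is_iso_channelI[of ?V] by simp
qed

lemma is_iso_channel_pure: "n > 0 \<Longrightarrow> is_iso_channel (pure_chan n)"
  using is_iso_channel_vector[of "\<lambda>b. delta b 0" n] by (simp add: pure_chan_def)

lemmas is_channel_pure = is_channel_iso_channel[OF is_iso_channel_pure]

lemma majorizes_embed_source:
  assumes "dout N \<le> dout M" "is_iso_channel W" "din W = dout N" "dout W = dout M"
    and "succ_same (ch_comp W N) M"
  shows "majorizes N M"
proof -
  have "\<not> dout N > dout M" using assms(1) by simp
  then show ?thesis unfolding majorizes_def using assms by metis
qed

lemma majorizes_embed_target:
  assumes "dout N > dout M" "is_iso_channel U" "din U = dout M" "dout U = dout N"
    and "succ_same N (ch_comp U M)"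
  shows "majorizes N M"
  using assms unfolding majorizes_def by metis

section \<open>Entropy axioms and the entropy of pure states\<close>

lemma entropy_mono:
  "channel_entropy H \<Longrightarrow> is_channel N \<Longrightarrow> is_channel M \<Longrightarrow> majorizes N M \<Longrightarrow> H N \<le> H M"
  unfolding channel_entropy_def by blast

lemma entropy_tensor:
  "channel_entropy H \<Longrightarrow> is_channel N \<Longrightarrow> is_channel M \<Longrightarrow> H (ch_tensor N M) = H N + H M"
  unfolding channel_entropy_def by blast

text \<open>The one-dimensional state is its own tensor square, so additivity makes its entropy 0.
  Embedding it into \<open>n\<close> dimensions yields |0><0|, and the two states majorize each
  other.\<close>

lemma entropy_pure:
  assumes H: "channel_entropy H" and n: "n > 0"
  shows "H (pure_chan n) = 0"
proof -
  have "ch_tensor (pure_chan 1) (pure_chan 1) = pure_chan 1"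
    unfolding ch_tensor_eq by (simp add: pure_chan_def, intro kernel_chan_cong) simp
  then have one: "H (pure_chan 1) = 0"
    using entropy_tensor[OF H is_channel_pure is_channel_pure, of 1 1] by simp
  \<comment> \<open>Here \<open>pure_chan n\<close> acts as the embedding isometry from dimension 1
    to dimension \<open>n\<close>.\<close>
  have comp: "ch_comp (pure_chan n) (pure_chan 1) = pure_chan n"
    by (subst ch_comp_eq) (auto simp: pure_chan_def intro!: kernel_chan_cong)
  have refl: "succ_same (pure_chan n) (pure_chan n)"
    using channel_carrier[OF is_channel_pure[OF n]] n by (intro succ_same_refl) auto
  have "majorizes (pure_chan 1) (pure_chan n)"
    by (rule majorizes_embed_source[of _ _ "pure_chan n"])
      (use n refl comp is_iso_channel_pure[OF n] in auto)
  moreover have "majorizes (pure_chan n) (pure_chan 1)"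
  \<comment> \<open>Embedding the target requires a strictly larger source output, so equal
    dimensions are treated apart.\<close>
  proof (cases "n = 1")
    case True
    then show ?thesis using majorizes_same_output[OF refl is_channel_pure[OF n]] by simp
  next
    case False
    then show ?thesis
      by (intro majorizes_embed_target[of _ _ "pure_chan n"])
        (use n refl comp is_iso_channel_pure[OF n] in auto)
  qed
  ultimately have "H (pure_chan n) = H (pure_chan 1)"
    by (intro antisym entropy_mono[OF H] is_channel_pure n) auto
  then show ?thesis using one by simp
qed

subsection \<open>Channels whose Choi matrix is a projection\<close>

text \<open>The measurement \<open>{P, 1 - P}\<close>, followed by the preparation of \<open>|0><0|\<close> on the first outcome
  and of the normalised projection onto its complement on the second.\<close>

definition measure_chan :: "nat \<Rightarrow> nat \<Rightarrow> (nat \<Rightarrow> nat \<Rightarrow> complex) \<Rightarrow> chan" where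
  "measure_chan k n P = kernel_chan k n (\<lambda>i b j d. if b = d then
     if b = 0 then P i j else complex_of_real (1 / (real n - 1)) * (delta i j - P i j) else 0)"

text \<open>This normalises the complement of a projection \<open>P\<close>: in a partial trace over
  \<open>n\<close> dimensions the identity counts \<open>n\<close> times and \<open>P\<close>
  once.\<close>

lemma inverse_pred_mult:
  assumes "n \<ge> 2"
  shows "complex_of_real (1 / (real n - 1)) * (of_nat n * x - x) = x"
proof -
  have "of_nat n * x - x = complex_of_real (real n - 1) * x"
    by (simp add: algebra_simps)
  then show ?thesis
    using assms by (simp flip: of_real_mult mult.assoc)
qed

text \<open>Label 0 contributes \<open>p\<close>, and the \<open>n - 1\<close> other labels share
  \<open>q\<close> equally.\<close>

lemma sum_remaining_outcomes:
  assumes "n \<ge> 2"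
  shows "(\<Sum>b<n. if b = 0 then p else complex_of_real (1 / (real n - 1)) * q) = p + q"
proof -
  have "(\<Sum>b<n. if b = 0 then p else complex_of_real (1 / (real n - 1)) * q)
     = p + of_nat (n - 1) * (complex_of_real (1 / (real n - 1)) * q)"
    using assms by (subst sum.remove[of _ 0]) auto
  also have "of_nat (n - 1) = complex_of_real (real n - 1)"
    using assms by (simp add: of_nat_diff)
  also have "complex_of_real (real n - 1) * (complex_of_real (1 / (real n - 1)) * q) = q"
    using assms by (simp flip: of_real_mult mult.assoc)
  finally show ?thesis .
qed

lemma is_channel_measure:
  assumes "k > 0" "n \<ge> 2" "gram_projection k P"
  shows "is_channel (measure_chan k n P)"
  unfolding measure_chan_def is_channel_kernel_chan
proof (intro conjI allI impI)
  show "psd (choi_mat (kernel_chan k n (\<lambda>i b j d. if b = d then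
     if b = 0 then P i j else complex_of_real (1 / (real n - 1)) * (delta i j - P i j) else 0)))"
    using assms
    by (intro psd_controlled_projection[of _ "k * n" k P "1 / (real n - 1)" "\<lambda>i. i div n" "\<lambda>i. i mod n" n])
      (auto simp: choi_kernel_chan div_mod_bounds)
next
  fix a c assume "a < k" "c < k"
  then show "(\<Sum>b<n. if b = b then if b = 0 then P a c
      else complex_of_real (1 / (real n - 1)) * (delta a c - P a c) else 0) = delta a c"
    using sum_remaining_outcomes[OF assms(2)] by simp
qed (use assms in auto)

text \<open>The Choi kernel of \<^const>\<open>measure_chan\<close> with the \<open>n\<close>-dimensional part of the input and the output
  exchanged.\<close>

definition prepare_chan :: "nat \<Rightarrow> nat \<Rightarrow> (nat \<Rightarrow> nat \<Rightarrow> complex) \<Rightarrow> chan" where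
  "prepare_chan m n P = kernel_chan (m * n) n (\<lambda>i b j d. if i mod n = j mod n then
     if i mod n = 0 then P (i div n * n + b) (j div n * n + d)
     else complex_of_real (1 / (real n - 1)) *
       (delta (i div n * n + b) (j div n * n + d) - P (i div n * n + b) (j div n * n + d)) else 0)"

text \<open>On label 0 trace preservation is the hypothesis \<open>tr\<close>. On any other label
  the partial trace of \<open>1 - P\<close> is \<open>n - 1\<close> times \<open>delta\<close>,
  which the prefactor cancels.\<close>

lemma is_channel_prepare:
  assumes m: "m > 0" and n: "n \<ge> 2" and P: "gram_projection (m * n) P"
    and tr: "\<And>a c. a < m \<Longrightarrow> c < m \<Longrightarrow> (\<Sum>b<n. P (a * n + b) (c * n + b)) = delta a c"
  shows "is_channel (prepare_chan m n P)"
  unfolding prepare_chan_def is_channel_kernel_chan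
proof (intro conjI allI impI)
  show "psd (choi_mat (kernel_chan (m * n) n (\<lambda>i b j d. if i mod n = j mod n then
     if i mod n = 0 then P (i div n * n + b) (j div n * n + d)
     else complex_of_real (1 / (real n - 1)) *
       (delta (i div n * n + b) (j div n * n + d) - P (i div n * n + b) (j div n * n + d)) else 0)))"
    \<comment> \<open>The Choi index is ordered as reference, label, output. The label in the middle
      is \<open>i div n mod n\<close>; the index of \<open>P\<close> joins the two outer
      parts.\<close>
    using n P
    by (intro psd_controlled_projection[of _ "m * n * n" "m * n" P "1 / (real n - 1)"
          "\<lambda>i. i div n div n * n + i mod n" "\<lambda>i. i div n mod n" n])
      (auto simp: choi_kernel_chan div_mod_bounds pair_index_less)
next
  fix i j assume ij: "i < m * n" "j < m * n"
  note bounds = div_mod_bounds[OF ij(1)] div_mod_bounds[OF ij(2)]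
  define c where "c = complex_of_real (1 / (real n - 1))"
  have "(\<Sum>b<n. delta (i div n * n + b) (j div n * n + b)) = (\<Sum>b<n. delta (i div n) (j div n))"
    by (intro sum.cong refl) (simp add: delta_pair_index)
  moreover have "(\<Sum>b<n. P (i div n * n + b) (j div n * n + b)) = delta (i div n) (j div n)"
    using bounds by (intro tr)
  moreover have "c * (of_nat n * delta (i div n) (j div n) - delta (i div n) (j div n))
      = delta (i div n) (j div n)"
    unfolding c_def by (rule inverse_pred_mult[OF n])
  ultimately have *: "(\<Sum>b<n. c * (delta (i div n * n + b) (j div n * n + b)
      - P (i div n * n + b) (j div n * n + b))) = delta (i div n) (j div n)"
    by (simp only: sum_distrib_left[symmetric] sum_subtractf sum_constant card_lessThan)
  show "(\<Sum>b<n. if i mod n = j mod n then if i mod n = 0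
      then P (i div n * n + b) (j div n * n + b)
      else complex_of_real (1 / (real n - 1)) *
       (delta (i div n * n + b) (j div n * n + b) - P (i div n * n + b) (j div n * n + b)) else 0)
      = delta i j"
    unfolding c_def[symmetric] delta_div_mod[of i n j, symmetric] using * tr bounds
    by (cases "i mod n = j mod n"; cases "i mod n = 0") (simp_all add: delta_def[of _ "j mod n"])
qed (use m n in auto)

text \<open>From |0><0| one reaches \<open>N\<close>: the label 0 is certain, and on it
  \<open>prepare_chan\<close> applies \<open>N\<close> to the reference. The bound
  \<open>dout N \<ge> 2\<close> leaves room for the complementary labels.\<close>

lemma entropy_nonneg_if_projection:
  assumes H: "channel_entropy H" and N: "is_channel N" "dout N \<ge> 2"
    and P: "gram_projection (din N * dout N) (\<lambda>i j. choi_mat N $$ (i, j))"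
  shows "0 \<le> H N"
proof -
  define m n where "m = din N" and "n = dout N"
  define P where "P = (\<lambda>i j. choi_mat N $$ (i, j))"
  define E where "E = prepare_chan m n P"
  have pos: "0 < m" "2 \<le> n" using N channel_pos[OF N(1)] by (auto simp: m_def n_def)
  have E: "is_channel E"
    unfolding E_def using N P channel_trace[OF N(1)]
    by (intro is_channel_prepare) (auto simp: m_def n_def P_def kernel_def channel_pos)
  have "majorizes (pure_chan n) N"
  proof (rule majorizes_reference[of _ _ m E])
    \<comment> \<open>Mixing condition: summed over all labels, the blocks \<open>P\<close> and
      \<open>1 - P\<close> add up to the identity matrix.\<close>
    fix x y b d assume xy: "x < m" "y < m" "b < dout (pure_chan n)" "d < dout (pure_chan n)"
    have "(\<Sum>i<n. kernel E (x * n + i) b (y * n + i) d)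
      = (\<Sum>i<n. if i = 0 then P (x * n + b) (y * n + d) else complex_of_real (1 / (real n - 1))
          * (delta (x * n + b) (y * n + d) - P (x * n + b) (y * n + d)))"
      using xy by (intro sum.cong refl) (simp add: E_def prepare_chan_def pair_index_less)
    then show "(\<Sum>i<dout (pure_chan n). kernel E (x * dout (pure_chan n) + i) b
        (y * dout (pure_chan n) + i) d) = delta x y * delta b d"
      using xy pos by (simp add: sum_remaining_outcomes) (simp add: delta_pair_index)
  next
    fix a b c d assume *: "a < din N" "b < dout N" "c < din N" "d < dout N"
    have "(\<Sum>x<n. \<Sum>y<n. delta x 0 * delta y 0 * kernel E (a * n + x) b (c * n + y) d)
      = kernel E (a * n + 0) b (c * n + 0) d"
      using pos by (simp add: mult.assoc flip: sum_distrib_left)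
    also have "\<dots> = kernel N a b c d"
      unfolding E_def prepare_chan_def using * pos pair_index_less[of a m 0 n] pair_index_less[of c m 0 n]
      by (simp add: m_def n_def P_def kernel_def[of N])
    finally show "kernel N a b c d = (\<Sum>x<dout (pure_chan n). \<Sum>y<dout (pure_chan n).
        kernel (pure_chan n) (a mod din (pure_chan n)) x (c mod din (pure_chan n)) y
        * kernel E (a div din (pure_chan n) * dout (pure_chan n) + x) b
            (c div din (pure_chan n) * dout (pure_chan n) + y) d)"
      by (simp add: kernel_pure)
  qed (use N E pos in \<open>auto simp: is_channel_pure m_def n_def E_def prepare_chan_def\<close>)
  then have "H (pure_chan n) \<le> H N"
    using N pos by (intro entropy_mono[OF H]) (auto intro!: is_channel_pure)
  then show ?thesis using pos entropy_pure[OF H, of n] by simp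
qed

section \<open>The maximally entangled projector and the upper bound on the entropy\<close>

definition max_entangled :: "nat \<Rightarrow> nat \<Rightarrow> nat \<Rightarrow> complex" where
  "max_entangled m i j = delta (i div m) (i mod m) * delta (j div m) (j mod m) / of_nat m"

lemma sum_diagonal_pairs:
  "(\<Sum>t<m * m. delta (t div m) (t mod m) * f t) = (\<Sum>a<m. f (a * m + a))"
  unfolding sum_pair_index by simp

lemma gram_projection_max_entangled:
  assumes "m > 0"
  shows "gram_projection (m * m) (max_entangled m)"
  unfolding gram_projection_def
proof (intro allI impI)
  fix i j
  have "(\<Sum>t<m * m. max_entangled m i t * cnj (max_entangled m j t))
    = (\<Sum>t<m * m. delta (t div m) (t mod m) * (delta (t div m) (t mod m) *
        (delta (i div m) (i mod m) * delta (j div m) (j mod m) / (of_nat m * of_nat m))))"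
    by (intro sum.cong refl) (simp add: max_entangled_def mult_ac)
  also have "\<dots> = max_entangled m i j"
    unfolding sum_diagonal_pairs using assms by (simp add: max_entangled_def)
  finally show "(\<Sum>t<m * m. max_entangled m i t * cnj (max_entangled m j t)) = max_entangled m i j" .
qed

text \<open>A composition \<open>N \<succ> M \<succ> |0><0|\<close>: the first step takes the reference system as an
  input of \<open>M\<close> rather than as part of the isometry, which makes minimality of the
  realization a dimension count; the entangled input is supplied in the second step.\<close>

lemma entropy_nonpos_if_projection:
  assumes H: "channel_entropy H" and N: "is_channel N" "dout N \<ge> 2"
    and P: "gram_projection (din N * dout N) (\<lambda>i j. choi_mat N $$ (i, j))"
    and overlap: "\<And>a c a' c'. a < din N \<Longrightarrow> c < din N \<Longrightarrow> a' < din N \<Longrightarrow> c' < din N \<Longrightarrow>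
      (\<Sum>x<dout N. \<Sum>y<dout N. kernel N a x c y * cnj (kernel N a' x c' y))
        = delta a a' * delta c c' / of_nat (din N)"
  shows "H N \<le> 0"
proof -
  define m n where "m = din N" and "n = dout N"
  \<comment> \<open>Composition multiplies kernels entrywise, so the effect is conjugated to turn
    that sum into a Hilbert-Schmidt inner product with the Choi matrix.\<close>
  define P where "P = (\<lambda>i j. cnj (choi_mat N $$ (i, j)))"
  define c where "c = complex_of_real (1 / (real n - 1))"
  define E where "E = measure_chan (m * n) n P"
  define M where "M = measure_chan (m * m) n (max_entangled m)"
  have pos: "0 < m" "2 \<le> n" using N channel_pos[OF N(1)] by (auto simp: m_def n_def)
  have "gram_projection (m * n) P"
    using assms(4) unfolding P_def m_def n_def by (rule gram_projection_cnj)
  then have E: "is_channel E"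
    unfolding E_def using pos by (intro is_channel_measure) auto
  have M: "is_channel M"
    unfolding M_def using pos by (intro is_channel_measure gram_projection_max_entangled) auto
  have trace: "(\<Sum>x<n. P (a * n + x) (b * n + x)) = delta a b" if "a < m" "b < m" for a b
    using channel_trace[OF N(1), of a b] that
    by (simp add: P_def kernel_def m_def n_def flip: cnj_sum)
  have kernel_E: "kernel E (x * n + i) b (y * n + j) d = (if b = d then
      if b = 0 then P (x * n + i) (y * n + j)
      else c * (delta (x * n + i) (y * n + j) - P (x * n + i) (y * n + j)) else 0)"
    if "x < m" "y < m" "i < n" "j < n" "b < n" "d < n" for x y i j b d
    using that by (simp add: E_def measure_chan_def pair_index_less c_def)
  have kernel_M: "kernel M i b j d = (if b = d then if b = 0 then max_entangled m i j
      else c * (delta i j - max_entangled m i j) else 0)"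
    if "i < m * m" "j < m * m" "b < n" "d < n" for i j b d
    using that by (simp add: M_def measure_chan_def c_def)
  have "majorizes N M"
  proof (rule majorizes_reference[of _ _ m E])
    \<comment> \<open>Mixing condition: tracing \<open>P\<close> over the output of \<open>N\<close>
      gives \<open>delta x y\<close> by trace preservation, and the complementary outcomes are
      normalised by \<open>c\<close>.\<close>
    fix x y b d assume xy: "x < m" "y < m" "b < dout N" "d < dout N"
    have "(\<Sum>i<n. kernel E (x * n + i) b (y * n + i) d)
      = (\<Sum>i<n. if b = d then if b = 0 then P (x * n + i) (y * n + i) else
          c * (delta x y - P (x * n + i) (y * n + i)) else 0)"
      using xy unfolding n_def[symmetric]
      by (intro sum.cong refl) (simp add: kernel_E delta_pair_index)
    also have "\<dots> = delta x y * delta b d"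
    proof -
      have "c * (of_nat n * delta x y - delta x y) = delta x y"
        unfolding c_def by (rule inverse_pred_mult[OF pos(2)])
      then show ?thesis
        using trace[OF xy(1,2)]
        by (cases "b = d"; cases "d = 0")
          (simp_all add: sum_subtractf delta_def[of b] flip: sum_distrib_left)
    qed
    finally show "(\<Sum>i<dout N. kernel E (x * dout N + i) b (y * dout N + i) d) = delta x y * delta b d"
      by (simp add: n_def)
  next
    fix a b a' d assume *: "a < din M" "b < dout M" "a' < din M" "d < dout M"
    then have **: "a < m * m" "a' < m * m" "b < n" "d < n" by (auto simp: M_def measure_chan_def)
    note bounds = div_mod_bounds[OF **(1)] div_mod_bounds[OF **(2)]
    \<comment> \<open>Pulled back through \<open>N\<close>, the effect \<open>P\<close> becomes the
      maximally entangled projector. By \<open>overlap\<close>, the images of the matrix units under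
      \<open>N\<close> are orthogonal with squared norm \<open>1/m\<close>.\<close>
    have S1: "(\<Sum>x<n. \<Sum>y<n. kernel N (a mod m) x (a' mod m) y * P (a div m * n + x) (a' div m * n + y))
       = max_entangled m a a'"
      using overlap[of "a mod m" "a' mod m" "a div m" "a' div m"] bounds
      by (simp add: max_entangled_def m_def n_def P_def kernel_def delta_commute)
    \<comment> \<open>The identity effect pulls back to the identity, by trace preservation; the
      difference of the two gives the other outcomes.\<close>
    have "(\<Sum>x<n. \<Sum>y<n. kernel N (a mod m) x (a' mod m) y * delta (a div m * n + x) (a' div m * n + y))
      = (\<Sum>x<n. \<Sum>y<n. delta x y * (kernel N (a mod m) x (a' mod m) y * delta (a div m) (a' div m)))"
      by (intro sum.cong refl) (simp add: delta_pair_index)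
    also have "\<dots> = delta (a mod m) (a' mod m) * delta (a div m) (a' div m)"
      using channel_trace[OF N(1), of "a mod m" "a' mod m"] bounds
      by (simp add: m_def n_def flip: sum_distrib_right)
    finally have S2: "(\<Sum>x<n. \<Sum>y<n. kernel N (a mod m) x (a' mod m) y
        * delta (a div m * n + x) (a' div m * n + y)) = delta a a'"
      using delta_div_mod[of a m a'] by (simp add: mult.commute)
    have "(\<Sum>x<n. \<Sum>y<n. kernel N (a mod m) x (a' mod m) y
       * kernel E (a div m * n + x) b (a' div m * n + y) d) =
      (\<Sum>x<n. \<Sum>y<n. if b = d then if b = 0
         then kernel N (a mod m) x (a' mod m) y * P (a div m * n + x) (a' div m * n + y)
         else c * (kernel N (a mod m) x (a' mod m) y * delta (a div m * n + x) (a' div m * n + y)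
           - kernel N (a mod m) x (a' mod m) y * P (a div m * n + x) (a' div m * n + y)) else 0)"
      using bounds ** by (intro sum.cong refl)
        (simp add: kernel_E right_diff_distrib mult.left_commute[of c])
    also have "\<dots> = kernel M a b a' d"
      using ** S1 S2
      by (cases "b = d"; cases "d = 0") (simp_all add: kernel_M sum_subtractf flip: sum_distrib_left)
    finally show "kernel M a b a' d = (\<Sum>x<dout N. \<Sum>y<dout N. kernel N (a mod din N) x (a' mod din N) y
       * kernel E (a div din N * dout N + x) b (a' div din N * dout N + y) d)"
      by (simp add: m_def n_def)
  qed (use N M E in \<open>auto simp: M_def E_def measure_chan_def m_def n_def\<close>)
  then have "H N \<le> H M" by (rule entropy_mono[OF H N(1) M])
  \<comment> \<open>\<open>v\<close> is the maximally entangled unit vector, and \<open>W\<close>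
    prepares the corresponding state as the input of \<open>M\<close>.\<close>
  define v where "v i = delta (i div m) (i mod m) / of_real (sqrt (real m))" for i
  define W where "W = kernel_chan 1 (m * m) (\<lambda>a b c d. v b * cnj (v d))"
  have vv: "v i * cnj (v j) = max_entangled m i j" for i j
    by (simp add: v_def max_entangled_def flip: of_real_mult)
  have Q: "(\<Sum>i<m * m. \<Sum>j<m * m. max_entangled m i j * f i j)
     = (\<Sum>a<m. \<Sum>b<m. f (a * m + a) (b * m + b)) / of_nat m" for f
  proof -
    have "(\<Sum>i<m * m. \<Sum>j<m * m. max_entangled m i j * f i j)
      = (\<Sum>i<m * m. delta (i div m) (i mod m) * (\<Sum>j<m * m. delta (j div m) (j mod m) * (f i j / of_nat m)))"
      by (simp add: max_entangled_def sum_distrib_left mult.assoc)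
    then show ?thesis unfolding sum_diagonal_pairs by (simp add: sum_divide_distrib)
  qed
  have "(\<Sum>i<m * m. v i * cnj (v i)) = (\<Sum>i<m * m. delta (i div m) (i mod m) * (1 / of_nat m))"
    by (intro sum.cong refl) (simp add: vv, simp add: max_entangled_def delta_def)
  then have W: "is_iso_channel W"
    unfolding W_def using pos by (intro is_iso_channel_vector) (simp only: sum_diagonal_pairs, simp)
  \<comment> \<open>\<open>QQ\<close> says that the first outcome is certain on this state. Together
    with its trace \<open>Q1\<close>, this makes all other outcomes vanish, so the output is
    |0><0|.\<close>
  have QQ: "(\<Sum>i<m * m. \<Sum>j<m * m. max_entangled m i j * max_entangled m i j) = 1"
    unfolding Q using pos by (simp add: max_entangled_def)
  have Q1: "(\<Sum>i<m * m. \<Sum>j<m * m. max_entangled m i j * delta i j) = 1"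
    unfolding Q using pos by (simp add: delta_pair_index)
  have dims: "din M = m * m" "dout M = n" "din W = 1" "dout W = m * m"
    by (simp_all add: M_def W_def measure_chan_def)
  have "ch_comp M W = pure_chan n"
    unfolding pure_chan_def
  proof (subst ch_comp_eq)
    show "kernel_chan (din W) (dout M) (\<lambda>a b c d. \<Sum>x<din M. \<Sum>y<din M. kernel W a x c y * kernel M x b y d)
      = kernel_chan 1 n (\<lambda>a b c d. delta b 0 * delta d 0)"
      unfolding dims
    proof (rule kernel_chan_cong, goal_cases)
      case (1 a b a' d)
      have "(\<Sum>x<m * m. \<Sum>y<m * m. kernel W a x a' y * kernel M x b y d)
        = (\<Sum>x<m * m. \<Sum>y<m * m. if b = d then if b = 0
            then max_entangled m x y * max_entangled m x y
            else c * (max_entangled m x y * delta x y - max_entangled m x y * max_entangled m x y) else 0)"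
        using 1 by (intro sum.cong refl)
          (simp add: W_def kernel_M vv right_diff_distrib mult.left_commute[of c])
      also have "\<dots> = delta b 0 * delta d 0"
        using QQ Q1
        by (cases "b = d"; cases "b = 0")
          (simp_all add: delta_def[of _ 0] sum_subtractf flip: sum_distrib_left)
      finally show ?case .
    qed
  qed (simp add: dims)
  moreover have "succ_same M (ch_comp M W)"
    using channel_carrier[OF M] W channel_pos[OF M]
    by (intro succ_same_precomp) (auto simp: dims)
  ultimately have "majorizes M (pure_chan n)"
    using M by (auto intro: majorizes_same_output)
  then have "H M \<le> H (pure_chan n)"
    using M pos by (intro entropy_mono[OF H]) (auto intro!: is_channel_pure)
  with \<open>H N \<le> H M\<close> show ?thesis using pos entropy_pure[OF H, of n] by simp
qed

subsection \<open>Uniform states\<close>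

lemma psd_scaled_identity:
  assumes "A \<in> carrier_mat N N" "c \<ge> 0"
    and "\<And>i j. i < N \<Longrightarrow> j < N \<Longrightarrow> A $$ (i, j) = complex_of_real c * delta i j"
  shows "psd A"
  by (rule psd_gramI[OF assms(1), of "{..<N}" "\<lambda>_. c" "\<lambda>t i. delta i t"])
    (use assms(2,3) in \<open>auto simp: delta_commute simp flip: sum_distrib_left\<close>)

lemma is_channel_unif:
  assumes "n > 0"
  shows "is_channel (state_chan (unif n))"
  unfolding unif_chan_eq is_channel_kernel_chan
proof (intro conjI)
  show "psd (choi_mat (kernel_chan 1 n (\<lambda>a b c d. delta b d / of_nat n)))"
    by (rule psd_scaled_identity[of _ n "1 / real n"]) (auto simp: choi_kernel_chan)
qed (use assms in auto)

lemma din_unif [simp]: "din (state_chan (unif n)) = 1"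
  and dout_unif [simp]: "dout (state_chan (unif n)) = n"
  by (simp_all add: unif_chan_eq)

lemma ch_tensor_unif:
  "ch_tensor (state_chan (unif a)) (state_chan (unif b)) = state_chan (unif (a * b))"
  unfolding ch_tensor_eq din_unif dout_unif
  unfolding unif_chan_eq mult_1
  by (rule kernel_chan_cong) (simp add: div_mod_bounds delta_div_mod)

lemma ch_comp_trace:
  assumes N: "is_channel N" and M: "is_channel M" and dims: "dout M = din N"
    and ac: "a < din M" "c < din M"
  shows "(\<Sum>b<dout N. kernel (ch_comp N M) a b c b) = delta a c"
proof -
  have "(\<Sum>b<dout N. kernel (ch_comp N M) a b c b)
     = (\<Sum>b<dout N. \<Sum>x<din N. \<Sum>y<din N. kernel M a x c y * kernel N x b y b)"
    using ac by (subst ch_comp_eq[OF dims]) simp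
  also have "\<dots> = (\<Sum>x<din N. \<Sum>b<dout N. \<Sum>y<din N. kernel M a x c y * kernel N x b y b)"
    by (rule sum.swap)
  also have "\<dots> = (\<Sum>x<din N. \<Sum>y<din N. \<Sum>b<dout N. kernel M a x c y * kernel N x b y b)"
    by (intro sum.cong refl sum.swap)
  also have "\<dots> = (\<Sum>x<din N. \<Sum>y<din N. kernel M a x c y * delta x y)"
    by (intro sum.cong refl) (simp add: channel_trace[OF N] flip: sum_distrib_left)
  also have "\<dots> = delta a c"
    using channel_trace[OF M ac] by (simp add: dims)
  finally show ?thesis .
qed

text \<open>After embedding the smaller uniform state, the channel replacing every state by the
  uniform one is mixing with a trivial reference.\<close>

lemma entropy_unif_mono:
  assumes H: "channel_entropy H" and nk: "0 < n" "n \<le> k"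
  shows "H (state_chan (unif n)) \<le> H (state_chan (unif k))"
proof -
  define W where "W = iso_chan (mat k n (\<lambda>(i, j). delta i j))"
  have W: "is_iso_channel W" unfolding W_def
  proof (intro is_iso_channelI isometryI)
    fix a c assume "a < dim_col (mat k n (\<lambda>(i, j). delta i j))" "c < dim_col (mat k n (\<lambda>(i, j). delta i j))"
    then show "(\<Sum>b<dim_row (mat k n (\<lambda>(i, j). delta i j)). mat k n (\<lambda>(i, j). delta i j) $$ (b, a)
        * cnj (mat k n (\<lambda>(i, j). delta i j) $$ (b, c))) = delta a c"
      using nk by simp
  qed (use nk in simp)
  have dims: "din W = n" "dout W = k" by (simp_all add: W_def iso_chan_eq)
  \<comment> \<open>The replacement channel: its output depends only on the trace of the input, so
    below only the trace of \<open>X\<close> is needed.\<close>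
  define E where "E = kernel_chan k k (\<lambda>i b j d. delta i j * delta b d / of_nat k)"
  define X where "X = ch_comp W (state_chan (unif n))"
  have X: "din X = 1" "dout X = k" "choi_mat X \<in> carrier_mat (din X * dout X) (din X * dout X)"
    using choi_comp_carrier[of W "state_chan (unif n)"] by (simp_all add: X_def dims)
  have "psd (choi_mat E)"
    by (rule psd_scaled_identity[of _ "k * k" "1 / real k"])
      (auto simp: E_def choi_kernel_chan delta_div_mod)
  then have E: "is_channel E"
    unfolding E_def is_channel_kernel_chan using nk by (simp flip: sum_divide_distrib)
  have "mixing_real 1 1 k (1, id_chan 1, E)"
    using nk by (intro mixing_realI E) (auto simp: E_def is_iso_channel_id)
  moreover have "super_apply (1, id_chan 1, E) X = ch_comp E X"
    using super_apply_one[OF X(3)] ch_comp_id_right[OF X(3)] by (simp add: X)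
  moreover have "ch_comp E X = state_chan (unif k)"
  proof -
    have trace: "(\<Sum>x<k. kernel X 0 x 0 x) = 1"
      using ch_comp_trace[OF is_channel_iso_channel[OF W] is_channel_unif[OF nk(1)], of 0 0]
      by (simp add: X_def dims)
    show ?thesis
      unfolding unif_chan_eq
    proof (subst ch_comp_eq)
      show "kernel_chan (din X) (dout E) (\<lambda>a b c d. \<Sum>x<din E. \<Sum>y<din E. kernel X a x c y * kernel E x b y d)
        = kernel_chan 1 k (\<lambda>a b c d. delta b d / of_nat k)"
        unfolding X E_def din_kernel_chan dout_kernel_chan
      proof (rule kernel_chan_cong, goal_cases)
        case (1 a b c d)
        have "(\<Sum>x<k. \<Sum>y<k. kernel X a x c y * kernel E x b y d)
          = (\<Sum>x<k. \<Sum>y<k. delta x y * (kernel X 0 x 0 y * (delta b d / of_nat k)))"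
          using 1 by (intro sum.cong refl) (simp add: E_def)
        also have "\<dots> = (\<Sum>x<k. kernel X 0 x 0 x) * (delta b d / of_nat k)"
          unfolding sum_distrib_right by (intro sum.cong refl) (simp del: times_divide_eq_right)
        finally show ?case using trace by (simp add: E_def)
      qed
    qed (simp_all add: X E_def)
  qed
  ultimately have "succ_same X (state_chan (unif k))"
    unfolding succ_same_def by (intro conjI exI[of _ "(1, id_chan 1, E)"]) (simp_all add: X)
  then have "majorizes (state_chan (unif n)) (state_chan (unif k))"
    using W nk by (intro majorizes_embed_source[of _ _ W]) (simp_all add: X_def dims)
  then show ?thesis
    using nk by (intro entropy_mono[OF H] is_channel_unif) auto
qed

text \<open>Squeezing powers of \<open>n\<close> between consecutive powers of 2 confines
  \<open>k * f n\<close> and \<open>k * log 2 n\<close> to the same unit interval, for every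
  \<open>k\<close>.\<close>

lemma additive_mono_eq_log2:
  fixes f :: "nat \<Rightarrow> real"
  assumes mult: "\<And>a b. 0 < a \<Longrightarrow> 0 < b \<Longrightarrow> f (a * b) = f a + f b"
    and mono: "\<And>a b. 0 < a \<Longrightarrow> a \<le> b \<Longrightarrow> f a \<le> f b"
    and two: "f 2 = 1" and n: "0 < n"
  shows "f n = log 2 (real n)"
proof -
  have "f 1 = 0" using mult[of 1 1] by simp
  then have pow: "f (a ^ k) = real k * f a" if "0 < a" for a k
    using that by (induction k) (simp_all add: mult algebra_simps)
  have "real k * \<bar>f n - log 2 (real n)\<bar> \<le> 1" for k
  proof -
    obtain j where j: "2 ^ j \<le> n ^ k" "n ^ k < 2 ^ (j + 1)"
      using ex_power_ivl1[of 2 "n ^ k"] n by auto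
    have f: "real j \<le> real k * f n" "real k * f n \<le> real j + 1"
      using mono[of "2 ^ j" "n ^ k"] mono[of "n ^ k" "2 ^ (j + 1)"] j n two pow[of n k]
        pow[of 2 j] pow[of 2 "j + 1"] by auto
    have "real 2 ^ j \<le> real n ^ k" "real n ^ k \<le> real 2 ^ (j + 1)"
      using j by (metis of_nat_le_iff of_nat_power less_imp_le)+
    then have "log 2 (2 ^ j) \<le> log 2 (real n ^ k)" "log 2 (real n ^ k) \<le> log 2 (2 ^ (j + 1))"
      using n by (auto intro!: log_mono simp del: log_pow_cancel log_nat_power power_Suc)
    then have "real j \<le> real k * log 2 (real n)" "real k * log 2 (real n) \<le> real j + 1"
      using n by (simp_all add: log_nat_power del: power_Suc)
    with f show ?thesis by (simp add: abs_if algebra_simps)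
  qed
  \<comment> \<open>By the Archimedean property a positive gap would exceed 1 after multiplication
    by a large \<open>k\<close>.\<close>
  then have "\<not> 0 < \<bar>f n - log 2 (real n)\<bar>"
    using reals_Archimedean3 by (metis not_less)
  then show ?thesis by simp
qed

lemma entropy_unif:
  assumes H: "channel_entropy H" and n: "0 < n"
  shows "H (state_chan (unif n)) = log 2 (real n)"
proof (rule additive_mono_eq_log2[where f = "\<lambda>n. H (state_chan (unif n))", OF _ _ _ n])
  show "H (state_chan (unif (a * b))) = H (state_chan (unif a)) + H (state_chan (unif b))"
    if "0 < a" "0 < b" for a b
    using entropy_tensor[OF H] that by (simp add: is_channel_unif flip: ch_tensor_unif)
qed (use H in \<open>auto simp: entropy_unif_mono channel_entropy_def\<close>)

subsection \<open>Isometry channels\<close>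

text \<open>The Choi matrix is the rank-one matrix of the vectorised isometry tensored with the
  uniform state. The squared norm \<open>m\<close> of that vector cancels the eigenvalue
  \<open>1/m\<close>, which is why the uniform state must have dimension \<open>m\<close>. Both
  entropy bounds for projections then apply.\<close>

lemma entropy_isometry_tensor_unif:
  assumes H: "channel_entropy H" and V: "is_isometry V" "0 < dim_col V" "2 \<le> dim_row V * dim_col V"
  shows "H (ch_tensor (iso_chan V) (state_chan (unif (dim_col V)))) = 0"
proof -
  define m n where "m = dim_col V" and "n = dim_row V"
  define v where "v b a = V $$ (b, a)" for b a
  define N where "N = ch_tensor (iso_chan V) (state_chan (unif m))"
  have pos: "0 < m" "2 \<le> n * m" "0 < n" using V by (auto simp: m_def n_def intro: Nat.gr0I)
  have v: "(\<Sum>b<n. v b a * cnj (v b c)) = delta a c" if "a < m" "c < m" for a c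
    using isometry_entries[OF V(1)] that by (simp add: v_def m_def n_def)
  have N: "N = kernel_chan m (n * m)
    (\<lambda>a b c d. v (b div m) a * cnj (v (d div m) c) * (delta (b mod m) (d mod m) / of_nat m))"
    unfolding N_def ch_tensor_eq unfolding iso_chan_eq unif_chan_eq m_def[symmetric] n_def[symmetric]
    using pos by (simp, intro kernel_chan_cong) (simp add: div_mod_bounds v_def)
  have kernel_N: "kernel N a (b * m + s) c (d * m + t) = v b a * cnj (v d c) * (delta s t / of_nat m)"
    if "a < m" "c < m" "b < n" "d < n" "s < m" "t < m" for a b c d s t
    using that by (simp add: N pair_index_less)
  have proj: "gram_projection (m * (n * m)) (\<lambda>i j. choi_mat N $$ (i, j))"
    unfolding gram_projection_def
  proof (intro allI impI)
    fix i j assume ij: "i < m * (n * m)" "j < m * (n * m)"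
    \<comment> \<open>\<open>g\<close> is the vectorised isometry, and \<open>s\<close> is the index
      of the uniform factor.\<close>
    define g where "g i = v (i mod (n * m) div m) (i div (n * m))" for i
    define s where "s i = i mod (n * m) mod m" for i
    have choi: "choi_mat N $$ (i, j) = g i * cnj (g j) * (delta (s i) (s j) / of_nat m)"
      if "i < m * (n * m)" "j < m * (n * m)" for i j
      using that by (simp add: N choi_kernel_chan g_def s_def)
    have "s i < m" "s j < m" using pos by (simp_all add: s_def)
    have "(\<Sum>t<m * (n * m). choi_mat N $$ (i, t) * cnj (choi_mat N $$ (j, t)))
      = (\<Sum>t<m * (n * m). g t * cnj (g t) * (delta (s i) (s t) * (delta (s j) (s t) *
          (g i * cnj (g j) / (of_nat m * of_nat m)))))"
      using ij by (intro sum.cong refl) (simp add: choi)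
    also have "\<dots> = (\<Sum>a<m. \<Sum>b<n. \<Sum>t<m. v b a * cnj (v b a) * (delta (s i) t * (delta (s j) t *
          (g i * cnj (g j) / (of_nat m * of_nat m)))))"
      unfolding sum_pair_index by (intro sum.cong refl) (simp add: g_def s_def pair_index_less)
    also have "\<dots> = (\<Sum>a<m. \<Sum>b<n. v b a * cnj (v b a) * (delta (s j) (s i) *
          (g i * cnj (g j) / (of_nat m * of_nat m))))"
      unfolding sum_distrib_left[symmetric] using \<open>s i < m\<close> by (simp only: sum_delta_nat)
    \<comment> \<open>The \<open>m\<close> columns of \<open>V\<close> have norm 1, so the sum over
      \<open>a\<close> and \<open>b\<close> is \<open>m\<close> and removes one of the two factors
      \<open>1/m\<close>.\<close>
    also have "\<dots> = choi_mat N $$ (i, j)"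
      unfolding sum_distrib_right[symmetric] using ij pos
      by (simp add: v choi delta_commute mult_ac del: times_divide_eq_left times_divide_eq_right)
        (simp add: delta_commute)
    finally show "(\<Sum>t<m * (n * m). choi_mat N $$ (i, t) * cnj (choi_mat N $$ (j, t))) = choi_mat N $$ (i, j)" .
  qed
  have dims: "din N = m" "dout N = n * m" by (simp_all add: N)
  have carrier: "choi_mat N \<in> carrier_mat (m * (n * m)) (m * (n * m))"
    by (simp add: N choi_kernel_chan)
  have trace: "(\<Sum>b<n * m. kernel N a b c b) = delta a c" if "a < m" "c < m" for a c
  proof -
    have "(\<Sum>b<n * m. kernel N a b c b) = (\<Sum>b<n. \<Sum>s<m. v b a * cnj (v b c) / of_nat m)"
      unfolding sum_pair_index using that by (intro sum.cong refl) (simp add: kernel_N)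
    then show ?thesis using that pos v by simp
  qed
  have channel: "is_channel N"
    using trace psd_projection[OF carrier proj] carrier pos
    by (simp add: is_channel_def dims kernel_def delta_def)
  have overlap: "(\<Sum>x<n * m. \<Sum>y<n * m. kernel N a x c y * cnj (kernel N a' x c' y))
      = delta a a' * delta c c' / of_nat m" if "a < m" "c < m" "a' < m" "c' < m" for a c a' c'
  proof -
    \<comment> \<open>The factors in \<open>v\<close> are inner products of columns of
      \<open>V\<close>. The uniform factor contributes \<open>m\<close> terms of size
      \<open>1/m\<close> squared.\<close>
    have "(\<Sum>x<n * m. \<Sum>y<n * m. kernel N a x c y * cnj (kernel N a' x c' y))
      = (\<Sum>b<n. \<Sum>s<m. \<Sum>d<n. \<Sum>t<m. delta s t * (delta s t *
          (v b a * cnj (v b a') * (v d c' * cnj (v d c)) / (of_nat m * of_nat m))))"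
      unfolding sum_pair_index using that by (intro sum.cong refl) (simp add: kernel_N mult_ac)
    also have "\<dots> = (\<Sum>b<n. \<Sum>s<m. \<Sum>d<n. v b a * cnj (v b a') * (v d c' * cnj (v d c)) / (of_nat m * of_nat m))"
      by (intro sum.cong refl) (simp del: times_divide_eq_right)
    also have "\<dots> = (\<Sum>b<n. v b a * cnj (v b a') * (\<Sum>d<n. v d c' * cnj (v d c)) / of_nat m)"
      using pos by (simp add: sum_distrib_left sum_divide_distrib)
    also have "\<dots> = delta a a' * delta c c' / of_nat m"
      using that by (simp add: v delta_commute flip: sum_distrib_right sum_divide_distrib)
    finally show ?thesis .
  qed
  have "H N = 0"
    using entropy_nonneg_if_projection[OF H channel] entropy_nonpos_if_projection[OF H channel]
      proj overlap pos by (simp add: dims)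
  then show ?thesis by (simp add: N_def m_def)
qed

text \<open>Trace preservation determines the single Choi entry.\<close>

lemma iso_channel_trivial:
  assumes "is_iso_channel V" "din V = 1" "dout V = 1"
  shows "V = pure_chan 1"
proof -
  have "kernel V 0 0 0 0 = 1"
    using channel_trace[OF is_channel_iso_channel[OF assms(1)], of 0 0] assms by simp
  then have "kernel_chan 1 1 (kernel V) = pure_chan 1"
    unfolding pure_chan_def by (intro kernel_chan_cong) simp
  then show ?thesis
    using kernel_chan_kernel_channel[OF is_channel_iso_channel[OF assms(1)]] assms by simp
qed

theorem theorem17:
  fixes H :: "chan \<Rightarrow> real" and V :: chan
  assumes "channel_entropy H" and "is_iso_channel V"
  shows "H V = - log 2 (real (din V)) \<and> (din V > 1 \<longrightarrow> H V < 0)"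
proof -
  have "0 < din V" using assms(2) by (simp add: is_iso_channel_def)
  have "H V = - log 2 (real (din V))"
  \<comment> \<open>The product is the output dimension after tensoring with the uniform state; the
    projection arguments need it to be at least 2.\<close>
  proof (cases "dout V * din V \<ge> 2")
    case True
    obtain W where W: "is_isometry W" "dim_col W = din V" "dim_row W = dout V" "V = iso_chan W"
      using assms(2) by (auto simp: is_iso_channel_def)
    have "H (ch_tensor V (state_chan (unif (din V)))) = 0"
      using entropy_isometry_tensor_unif[OF assms(1) W(1)] W(2,3) True \<open>0 < din V\<close>
      by (simp flip: W(4))
    then show ?thesis
      using entropy_tensor[OF assms(1) is_channel_iso_channel[OF assms(2)] is_channel_unif]
        entropy_unif[OF assms(1)] \<open>0 < din V\<close> by (simp add: add_eq_0_iff2)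
  next
    case False
    \<comment> \<open>Both dimensions are then 1, and the claim is that the trivial state has
      entropy 0.\<close>
    then have "dout V * din V = 1"
      using \<open>0 < din V\<close> iso_channel_dim_le[OF assms(2)] by (cases "dout V * din V") auto
    then show ?thesis
      using iso_channel_trivial[OF assms(2)] entropy_pure[OF assms(1), of 1] by simp
  qed
  then show ?thesis by simp
qed

end
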